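(* Let $k\geq 2$ be an integer and let $P$ be a finite poset of width $w$ that does not contain $\mathbf{k}+\mathbf{k}$ as an induced subposet. Then every First-Fit chain partition of $P$ consists of at most $8(2k-3)w$ chains; that is, First-Fit partitions $P$ into at most $8(2k-3)w$ chains.
   Context: The width of a poset is the maximum size of an antichain. $\mathbf{k}+\mathbf{k}$ denotes the poset consisting of two disjoint chains $A,B$ with $|A|=|B|=k$ in which every element of $A$ is incomparable with every element of $B$. The First-Fit algorithm receives the elements of $P$ one at a time in some order and puts each new element $v$ into the first chain of the current chain partition all of whose elements are comparable to $v$, opening a new chain at the end if there is none. Equivalently, a First-Fit chain partition of $P$ is a sequence $C_1,\dots,C_q$ of nonempty disjoint chains covering $P$ such that for all $1\leq i<j\leq q$ and every $v\in C_j$ there is $u\in C_i$ incomparable to $v$; the chain partitions produced by First-Fit (over all input orders) are exactly the First-Fit chain partitions. *)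

theory Defs
  imports Main
begin

definition partial_order_on_set :: "'a set \<Rightarrow> ('a \<Rightarrow> 'a \<Rightarrow> bool) \<Rightarrow> bool" where
  "partial_order_on_set P le \<longleftrightarrow>
     (\<forall>x\<in>P. le x x) \<and>
     (\<forall>x\<in>P. \<forall>y\<in>P. le x y \<and> le y x \<longrightarrow> x = y) \<and>
     (\<forall>x\<in>P. \<forall>y\<in>P. \<forall>z\<in>P. le x y \<and> le y z \<longrightarrow> le x z)"

definition comparable :: "('a \<Rightarrow> 'a \<Rightarrow> bool) \<Rightarrow> 'a \<Rightarrow> 'a \<Rightarrow> bool" where
  "comparable le x y \<longleftrightarrow> le x y \<or> le y x"

definition is_chain :: "('a \<Rightarrow> 'a \<Rightarrow> bool) \<Rightarrow> 'a set \<Rightarrow> bool" where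
  "is_chain le C \<longleftrightarrow> (\<forall>x\<in>C. \<forall>y\<in>C. comparable le x y)"

definition is_antichain :: "('a \<Rightarrow> 'a \<Rightarrow> bool) \<Rightarrow> 'a set \<Rightarrow> bool" where
  "is_antichain le A \<longleftrightarrow> (\<forall>x\<in>A. \<forall>y\<in>A. x \<noteq> y \<longrightarrow> \<not> comparable le x y)"

definition width :: "'a set \<Rightarrow> ('a \<Rightarrow> 'a \<Rightarrow> bool) \<Rightarrow> nat" where
  "width P le = Max {card A | A. A \<subseteq> P \<and> is_antichain le A}"

text \<open>P contains k+k as an induced subposet: there are two chains A, B in P,
each of size k, with every element of A incomparable to every element of B
(the induced subposet on A \<union> B is then exactly k+k).\<close>
definition contains_kk :: "'a set \<Rightarrow> ('a \<Rightarrow> 'a \<Rightarrow> bool) \<Rightarrow> nat \<Rightarrow> bool" where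
  "contains_kk P le k \<longleftrightarrow>
     (\<exists>A B. A \<subseteq> P \<and> B \<subseteq> P \<and> card A = k \<and> card B = k \<and>
            is_chain le A \<and> is_chain le B \<and>
            (\<forall>a\<in>A. \<forall>b\<in>B. \<not> comparable le a b))"

definition first_fit_partition :: "'a set \<Rightarrow> ('a \<Rightarrow> 'a \<Rightarrow> bool) \<Rightarrow> 'a set list \<Rightarrow> bool" where
  "first_fit_partition P le Cs \<longleftrightarrow>
     (\<forall>i<length Cs. Cs ! i \<noteq> {} \<and> is_chain le (Cs ! i)) \<and>
     (\<forall>i<length Cs. \<forall>j<length Cs. i \<noteq> j \<longrightarrow> Cs ! i \<inter> Cs ! j = {}) \<and>
     \<Union>(set Cs) = P \<and>
     (\<forall>i j. i < j \<and> j < length Cs \<longrightarrow>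
        (\<forall>v\<in>Cs ! j. \<exists>u\<in>Cs ! i. \<not> comparable le u v))"

end

theory Submission
  imports Defs
begin

text \<open>Every point of \<open>P\<close> gets an interval of integers so that incomparable points get intersecting
  intervals and no integer lies in more than \<open>W = (2k - 3)w\<close> intervals. A First-Fit chain partition
  then satisfies: for \<open>i < j\<close>, every interval of class \<open>j\<close> meets an interval of class \<open>i\<close>.

  The integers are regarded as columns, which are labelled row by row, one row per class. An active
  column is hit by row \<open>i\<close> if it lies in an interval of class \<open>i\<close>, and is also labelled if an adjacent
  active column is hit. An unlabelled column misses the row, and it dies when its misses exceed three
  times its hits. As every interval of a later class contains a labelled active column, some column
  survives all \<open>q\<close> rows. Each side of a survivor supplies at most \<open>q/4\<close> labels, up to the slack of its
  current neighbour on that side; so a survivor of maximal slack has at least \<open>q/8\<close> hits, whence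
  \<open>q \<le> 8W\<close>.\<close>

section \<open>The column construction\<close>

text \<open>The order is a parameter so that left and right neighbours (\<open><\<close> and
  \<open>>\<close>) are treated by one argument.\<close>

definition nbr :: "('p \<Rightarrow> 'p \<Rightarrow> bool) \<Rightarrow> 'p set \<Rightarrow> 'p \<Rightarrow> 'p \<Rightarrow> bool" where
  "nbr lt X p u \<longleftrightarrow> u \<in> X \<and> lt u p \<and> (\<forall>z\<in>X. lt z p \<longrightarrow> z = u \<or> lt z u)"

definition labelled :: "nat set \<Rightarrow> nat set \<Rightarrow> nat \<Rightarrow> bool" where
  "labelled X R p \<longleftrightarrow> p \<in> R \<or> (\<exists>u\<in>R. nbr (<) X p u \<or> nbr (>) X p u)"

definition order_convex :: "nat set \<Rightarrow> bool" where
  "order_convex J \<longleftrightarrow> (\<forall>a\<in>J. \<forall>b\<in>J. {a..b} \<subseteq> J)"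

lemma order_convexD: "order_convex J \<Longrightarrow> a \<in> J \<Longrightarrow> b \<in> J \<Longrightarrow> a \<le> z \<Longrightarrow> z \<le> b \<Longrightarrow> z \<in> J"
  unfolding order_convex_def by (meson atLeastAtMost_iff subsetD)

lemma nbr_subset: "nbr lt X p u \<Longrightarrow> Y \<subseteq> X \<Longrightarrow> u \<in> Y \<Longrightarrow> nbr lt Y p u"
  unfolding nbr_def by blast

lemma nbr_less_ex:
  fixes X :: "nat set"
  assumes "finite X" "y \<in> X" "y < p"
  obtains u where "nbr (<) X p u" "y \<le> u"
proof -
  let ?u = "Max {z\<in>X. z < p}"
  have "?u \<in> {z\<in>X. z < p}" using assms by (intro Max_in) auto
  moreover have "z \<le> ?u" if "z \<in> X" "z < p" for z using assms that by (intro Max_ge) auto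
  ultimately have "nbr (<) X p ?u" "y \<le> ?u" using assms by (auto simp: nbr_def le_less)
  then show ?thesis using that by blast
qed

lemma nbr_greater_ex:
  fixes X :: "nat set"
  assumes "finite X" "y \<in> X" "p < y"
  obtains u where "nbr (>) X p u" "u \<le> y"
proof -
  let ?u = "Min {z\<in>X. p < z}"
  have "?u \<in> {z\<in>X. p < z}" using assms by (intro Min_in) auto
  moreover have "?u \<le> z" if "z \<in> X" "p < z" for z using assms that by (intro Min_le) auto
  ultimately have "nbr (>) X p ?u" "?u \<le> y" using assms by (auto simp: nbr_def le_less)
  then show ?thesis using that by blast
qed

text \<open>If \<open>I\<close> and \<open>J\<close> share no active column, an active
  \<open>y\<close> of \<open>I\<close> lies to one side of \<open>J\<close>. The extreme active
  column of \<open>J\<close> on that side has its neighbour between \<open>y\<close> and a common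
  point \<open>m\<close>, hence in \<open>I\<close>.\<close>

lemma labelled_in_meeting_interval:
  fixes X :: "nat set"
  assumes "finite X" "order_convex I" "order_convex J" "I \<inter> J \<noteq> {}"
    and IX: "I \<inter> X \<noteq> {}" and JX: "J \<inter> X \<noteq> {}" and IR: "I \<subseteq> R"
  shows "\<exists>x\<in>J \<inter> X. labelled X R x"
proof (cases "I \<inter> J \<inter> X = {}")
  case False
  then show ?thesis using IR by (auto simp: labelled_def)
next
  case True
  obtain m where m: "m \<in> I" "m \<in> J" using assms by blast
  obtain y where y: "y \<in> I" "y \<in> X" using IX by blast
  have yJ: "y \<notin> J" using True y by blast
  have fin: "finite (J \<inter> X)" using assms by simp
  have conv: "z \<in> J" if "a \<in> J" "b \<in> J" "a \<le> z" "z \<le> b" for a b z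
    using order_convexD assms(3) that by blast
  show ?thesis
  proof (cases "y < m")
    case True
    let ?x = "Min (J \<inter> X)"
    have x: "?x \<in> J \<inter> X" using fin JX by (rule Min_in)
    have "y < ?x"
      using conv[OF IntD1[OF x] m(2), of y] yJ True by linarith
    then obtain u where u: "nbr (<) X ?x u" "y \<le> u"
      using nbr_less_ex assms(1) y(2) by blast
    then have "u \<notin> J" using Min_le[OF fin, of u] by (auto simp: nbr_def)
    then have "u \<le> m"
      using conv[OF m(2) IntD1[OF x], of u] u(1) unfolding nbr_def by linarith
    then have "u \<in> I" using order_convexD[OF assms(2) y(1) m(1)] u(2) by blast
    then show ?thesis using x u IR by (auto simp: labelled_def)
  next
    case False
    let ?x = "Max (J \<inter> X)"
    have x: "?x \<in> J \<inter> X" using fin JX by (rule Max_in)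
    have "?x < y"
      using conv[OF m(2) IntD1[OF x], of y] yJ False by linarith
    then obtain u where u: "nbr (>) X ?x u" "u \<le> y"
      using nbr_greater_ex assms(1) y(2) by blast
    then have "u \<notin> J" using Max_ge[OF fin, of u] by (auto simp: nbr_def)
    then have "m \<le> u"
      using conv[OF IntD1[OF x] m(2), of u] u(1) unfolding nbr_def by linarith
    then have "u \<in> I" using order_convexD[OF assms(2) m(1) y(1)] u(2) by blast
    then show ?thesis using x u IR by (auto simp: labelled_def)
  qed
qed

section \<open>Evolution of hits, misses and active columns\<close>

definition hits :: "(nat \<Rightarrow> nat set) \<Rightarrow> nat \<Rightarrow> nat \<Rightarrow> nat" where
  "hits U i p = card {t. t < i \<and> p \<in> U t}"

lemma card_below_Suc:
  "card {t. t < Suc i \<and> Q t} = card {t. t < i \<and> Q t} + (if Q i then 1 else 0)"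
proof -
  have "{t. t < Suc i \<and> Q t} = (if Q i then insert i {t. t < i \<and> Q t} else {t. t < i \<and> Q t})"
    using less_Suc_eq by auto
  then show ?thesis by simp
qed

lemma hits_0 [simp]: "hits U 0 p = 0"
  by (simp add: hits_def)

lemma hits_Suc [simp]: "hits U (Suc i) p = hits U i p + (if p \<in> U i then 1 else 0)"
  unfolding hits_def by (rule card_below_Suc)

text \<open>Both components are built together: labels depend on the active set, deaths on the
  misses. Dead columns keep counting misses, so \<open>rows_le\<close> can speak of every
  column.\<close>

primrec state :: "nat set \<Rightarrow> (nat \<Rightarrow> nat set) \<Rightarrow> nat \<Rightarrow> nat set \<times> (nat \<Rightarrow> nat)" where
  "state S U 0 = (S, \<lambda>_. 0)"
| "state S U (Suc i) =
     (let X = fst (state S U i);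
          c = (\<lambda>p. snd (state S U i) p + (if labelled X (U i) p then 0 else 1))
      in ({p\<in>X. c p \<le> 3 * hits U (Suc i) p}, c))"

definition active :: "nat set \<Rightarrow> (nat \<Rightarrow> nat set) \<Rightarrow> nat \<Rightarrow> nat set" where
  "active S U i = fst (state S U i)"

definition misses :: "nat set \<Rightarrow> (nat \<Rightarrow> nat set) \<Rightarrow> nat \<Rightarrow> nat \<Rightarrow> nat" where
  "misses S U i = snd (state S U i)"

lemma active_0 [simp]: "active S U 0 = S"
  and misses_0 [simp]: "misses S U 0 p = 0"
  by (simp_all add: active_def misses_def)

lemma misses_Suc:
  "misses S U (Suc i) p = misses S U i p + (if labelled (active S U i) (U i) p then 0 else 1)"
  by (simp add: active_def misses_def Let_def)

lemma active_Suc: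
  "active S U (Suc i) = {p\<in>active S U i. misses S U (Suc i) p \<le> 3 * hits U (Suc i) p}"
  by (simp add: active_def misses_def Let_def)

lemma misses_le: "p \<in> active S U i \<Longrightarrow> misses S U i p \<le> 3 * hits U i p"
  by (cases i) (auto simp: active_Suc)

lemma active_antimono: "i \<le> j \<Longrightarrow> active S U j \<subseteq> active S U i"
  by (induction rule: dec_induct) (auto simp: active_Suc)

text \<open>A label adds no miss and hits never decrease, so a column dies only in a row that leaves
  it unlabelled.\<close>

lemma labelled_active_Suc:
  assumes "p \<in> active S U i" "labelled (active S U i) (U i) p"
  shows "p \<in> active S U (Suc i)"
  using misses_le[OF assms(1)] assms by (simp add: active_Suc misses_Suc)

text \<open>The neighbour is taken afresh in each row, since deaths replace it.\<close>

definition nbr_hits ::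
  "(nat \<Rightarrow> nat \<Rightarrow> bool) \<Rightarrow> nat set \<Rightarrow> (nat \<Rightarrow> nat set) \<Rightarrow> nat \<Rightarrow> nat \<Rightarrow> nat" where
  "nbr_hits lt S U i p = card {t. t < i \<and> (\<exists>u\<in>U t. nbr lt (active S U t) p u)}"

lemma nbr_hits_Suc:
  "nbr_hits lt S U (Suc i) p =
     nbr_hits lt S U i p + (if \<exists>u\<in>U i. nbr lt (active S U i) p u then 1 else 0)"
  unfolding nbr_hits_def by (rule card_below_Suc)

text \<open>A neighbour pays for each of its hits with three misses, except for its current slack
  \<open>3 * hits - misses\<close>; when it dies, this debt has been settled.\<close>

lemma nbr_hits_le:
  assumes asym: "\<And>a b. lt a b \<Longrightarrow> \<not> lt b a"
    and ex: "\<And>X y. finite X \<Longrightarrow> y \<in> X \<Longrightarrow> lt y p \<Longrightarrow> \<exists>u. nbr lt X p u"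
    and "finite S"
  shows "p \<in> active S U i \<Longrightarrow>
    (\<forall>u. nbr lt (active S U i) p u \<longrightarrow>
       4 * nbr_hits lt S U i p + misses S U i u \<le> i + 3 * hits U i u) \<and>
    ((\<nexists>u. nbr lt (active S U i) p u) \<longrightarrow> 4 * nbr_hits lt S U i p \<le> i)"
proof (induction i)
  case 0
  then show ?case by (simp add: nbr_hits_def)
next
  case (Suc i)
  let ?X = "active S U i" and ?Y = "active S U (Suc i)"
  have sub: "?Y \<subseteq> ?X" by (auto simp: active_Suc)
  then have pX: "p \<in> ?X" using Suc.prems by (rule subsetD)
  have "finite ?X" using finite_subset[OF active_antimono[of 0 i S U]] \<open>finite S\<close> by simp
  have uniq: "u = u'" if "nbr lt X p u" "nbr lt X p u'" for X u u'
    using that asym[of u u'] unfolding nbr_def by metis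
  have IH: "4 * nbr_hits lt S U i p + misses S U i u \<le> i + 3 * hits U i u" if "nbr lt ?X p u" for u
    using Suc.IH[OF pX] that by blast
  show ?case
  proof (cases "\<exists>u. nbr lt ?X p u")
    case False
    have "\<nexists>u. nbr lt ?Y p u"
    proof
      assume "\<exists>u. nbr lt ?Y p u"
      then obtain u where "u \<in> ?X" "lt u p" using sub unfolding nbr_def by blast
      then show False using ex[OF \<open>finite ?X\<close>] False by metis
    qed
    moreover have "4 * nbr_hits lt S U i p \<le> i" using Suc.IH[OF pX] False by blast
    moreover have "\<not> (\<exists>u\<in>U i. nbr lt ?X p u)" using False by blast
    ultimately show ?thesis by (simp add: nbr_hits_Suc)
  next
    case True
    then obtain u where u: "nbr lt ?X p u" by blast
    have hit: "(\<exists>u\<in>U i. nbr lt ?X p u) \<longleftrightarrow> u \<in> U i" using u uniq[OF u] by metis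
    show ?thesis
    proof (cases "u \<in> ?Y")
      case alive: True
      have u': "nbr lt ?Y p u" using nbr_subset[OF u sub alive] .
      \<comment> \<open>If \<open>u\<close> is hit, both sides grow by 4 (the right one by 1 for the
        row and 3 for the hit). Otherwise the left side grows by at most 1.\<close>
      have "4 * nbr_hits lt S U (Suc i) p + misses S U (Suc i) u \<le> Suc i + 3 * hits U (Suc i) u"
        using IH[OF u] hit by (simp add: nbr_hits_Suc misses_Suc labelled_def)
      then show ?thesis using u' uniq[OF u'] by metis
    next
      case False
      have "u \<in> ?X" using u by (simp add: nbr_def)
      then have "\<not> labelled ?X (U i) u" using False labelled_active_Suc by metis
      moreover have "3 * hits U (Suc i) u < misses S U (Suc i) u"
        using False \<open>u \<in> ?X\<close> by (simp add: active_Suc)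
      ultimately have "4 * nbr_hits lt S U (Suc i) p \<le> Suc i"
        using IH[OF u] hit by (simp add: nbr_hits_Suc misses_Suc labelled_def)
      \<comment> \<open>The dead neighbour leaves no debt, so the bound passes to any successor
        \<open>v\<close>, whose slack is nonnegative.\<close>
      moreover have "misses S U (Suc i) v \<le> 3 * hits U (Suc i) v" if "nbr lt ?Y p v" for v
        using that misses_le unfolding nbr_def by blast
      ultimately show ?thesis by (metis add_le_mono)
    qed
  qed
qed

text \<open>A row that neither hits \<open>p\<close> nor counts as a miss labels \<open>p\<close>
  through its left or right neighbour.\<close>

lemma rows_le:
  "i \<le> hits U i p + nbr_hits (<) S U i p + nbr_hits (>) S U i p + misses S U i p"
proof (induction i)
  case (Suc i)
  then show ?case by (auto simp: nbr_hits_Suc misses_Suc labelled_def)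
qed simp

lemma rows_le_8_hits:
  assumes "finite S" "active S U q \<noteq> {}"
  shows "\<exists>p. q \<le> 8 * hits U q p"
proof -
  let ?s = "\<lambda>p. 3 * hits U q p - misses S U q p"
  have fin: "finite (active S U q)"
    using finite_subset[OF active_antimono[of 0 q S U]] assms(1) by simp
  define M where "M = Max (?s ` active S U q)"
  have "M \<in> ?s ` active S U q" unfolding M_def using fin assms(2) by (intro Max_in) auto
  then obtain p where p: "p \<in> active S U q" "M = ?s p" by blast
  have M: "?s u \<le> M" if "u \<in> active S U q" for u
    unfolding M_def using fin that by (intro Max_ge) auto
  have side: "4 * nbr_hits lt S U q p \<le> q + M"
    if "\<And>a b. lt a b \<Longrightarrow> \<not> lt b a"
      and "\<And>X y. finite X \<Longrightarrow> y \<in> X \<Longrightarrow> lt y p \<Longrightarrow> \<exists>u. nbr lt X p u" for lt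
  proof -
    have *: "(\<forall>u. nbr lt (active S U q) p u \<longrightarrow>
        4 * nbr_hits lt S U q p + misses S U q u \<le> q + 3 * hits U q u) \<and>
      ((\<nexists>u. nbr lt (active S U q) p u) \<longrightarrow> 4 * nbr_hits lt S U q p \<le> q)"
      by (rule nbr_hits_le[OF _ _ assms(1) p(1)]) (fact that)+
    show ?thesis
    proof (cases "\<exists>u. nbr lt (active S U q) p u")
      case True
      then obtain u where u: "nbr lt (active S U q) p u" by blast
      then have "u \<in> active S U q" by (simp add: nbr_def)
      moreover have "4 * nbr_hits lt S U q p + misses S U q u \<le> q + 3 * hits U q u"
        using * u by blast
      ultimately show ?thesis using M[of u] misses_le[of u S U q] by linarith
    next
      case False
      then show ?thesis using * by (simp add: trans_le_add1)
    qed
  qed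
  have "4 * nbr_hits (<) S U q p \<le> q + M"
    by (rule side) (auto elim: nbr_less_ex)
  moreover have "4 * nbr_hits (>) S U q p \<le> q + M"
    by (rule side) (auto elim: nbr_greater_ex)
  \<comment> \<open>With h hits and m misses of \<open>p\<close>, so M = 3h - m, four times
    \<open>rows_le\<close> gives 4q <= 4h + 2(q + M) + 4m, that is, q <= 8h - M.\<close>
  ultimately have "q \<le> 8 * hits U q p"
    using rows_le[of q U p S] p(2) misses_le[OF p(1)] by linarith
  then show ?thesis ..
qed

section \<open>The bound for interval representations\<close>

lemma first_fit_intervals:
  fixes C :: "nat \<Rightarrow> 'v set" and I :: "'v \<Rightarrow> nat set"
  assumes nonempty: "\<And>i. i < q \<Longrightarrow> C i \<noteq> {}"
    and conv: "\<And>i v. i < q \<Longrightarrow> v \<in> C i \<Longrightarrow> order_convex (I v)"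
    and bounded: "\<And>i v. i < q \<Longrightarrow> v \<in> C i \<Longrightarrow> I v \<noteq> {} \<and> I v \<subseteq> {..n}"
    and meet: "\<And>i j v. i < j \<Longrightarrow> j < q \<Longrightarrow> v \<in> C j \<Longrightarrow> \<exists>u\<in>C i. I u \<inter> I v \<noteq> {}"
    and density: "\<And>p. card {i. i < q \<and> p \<in> (\<Union>v\<in>C i. I v)} \<le> W"
  shows "q \<le> 8 * W"
proof (cases q)
  case (Suc m)
  define U where "U i = (\<Union>v\<in>C i. I v)" for i
  let ?X = "active {..n} U"
  have finX: "finite (?X i)" for i
    using finite_subset[OF active_antimono[of 0 i "{..n}" U]] by simp
  \<comment> \<open>Before row \<open>i\<close>, every interval of a class not yet processed still
    contains an active column.\<close>
  have inv: "\<forall>j v. i \<le> j \<longrightarrow> j < q \<longrightarrow> v \<in> C j \<longrightarrow> I v \<inter> ?X i \<noteq> {}" for i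
  proof (induction i)
    case 0
    then show ?case using bounded by fastforce
  next
    case (Suc i)
    show ?case
    proof (intro allI impI)
      fix j v assume j: "Suc i \<le> j" "j < q" and v: "v \<in> C j"
      have IH: "I w \<inter> ?X i \<noteq> {}" if "i \<le> l" "l < q" "w \<in> C l" for l w
        using Suc.IH that by blast
      obtain u where u: "u \<in> C i" "I u \<inter> I v \<noteq> {}" using meet[of i j v] j v by auto
      have "\<exists>x\<in>I v \<inter> ?X i. labelled (?X i) (U i) x"
      proof (rule labelled_in_meeting_interval)
        show "I u \<inter> ?X i \<noteq> {}" using IH[of i u] u j by simp
        show "I v \<inter> ?X i \<noteq> {}" using IH[of j v] v j by simp
        show "I u \<subseteq> U i" using u by (auto simp: U_def)
        show "order_convex (I u)" using conv[of i u] u j by simp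
        show "order_convex (I v)" using conv[of j v] v j by simp
      qed (use finX u in auto)
      then show "I v \<inter> ?X (Suc i) \<noteq> {}" using labelled_active_Suc by blast
    qed
  qed
  \<comment> \<open>No class follows the last one; the survivor of row \<open>m\<close> is an active
    column hit by class \<open>m\<close> itself.\<close>
  obtain v where v: "v \<in> C m" using nonempty[of m] Suc by auto
  then obtain x where x: "x \<in> I v" "x \<in> ?X m" using inv[of m] Suc by blast
  then have "labelled (?X m) (U m) x" using v by (auto simp: labelled_def U_def)
  then have "?X q \<noteq> {}" using labelled_active_Suc x Suc by blast
  then obtain p where "q \<le> 8 * hits U q p" using rows_le_8_hits[of "{..n}"] by blast
  then show ?thesis using density[of p] by (simp add: hits_def U_def)
qed simp

section \<open>An interval supergraph of the incomparability graph\<close>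

lemma card_le_width:
  assumes "finite P" "A \<subseteq> P" "is_antichain le A"
  shows "card A \<le> width P le"
proof -
  have "{card A | A. A \<subseteq> P \<and> is_antichain le A} \<subseteq> card ` Pow P" by auto
  then have "finite {card A | A. A \<subseteq> P \<and> is_antichain le A}"
    using assms(1) finite_subset by blast
  then show ?thesis unfolding width_def using assms by (intro Max_ge) auto
qed

lemma is_chain_subset: "is_chain le A \<Longrightarrow> B \<subseteq> A \<Longrightarrow> is_chain le B"
  unfolding is_chain_def by blast

lemma is_chain_dual: "is_chain (\<lambda>x y. le y x) A \<longleftrightarrow> is_chain le A"
  by (auto simp: is_chain_def comparable_def)

section \<open>Finite posets and ranks\<close>

locale finite_poset =
  fixes P :: "'a set" and le :: "'a \<Rightarrow> 'a \<Rightarrow> bool"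
  assumes finP: "finite P" and po: "partial_order_on_set P le"
begin

lemma le_refl: "x \<in> P \<Longrightarrow> le x x"
  and le_antisym: "x \<in> P \<Longrightarrow> y \<in> P \<Longrightarrow> le x y \<Longrightarrow> le y x \<Longrightarrow> x = y"
  and le_trans: "x \<in> P \<Longrightarrow> y \<in> P \<Longrightarrow> z \<in> P \<Longrightarrow> le x y \<Longrightarrow> le y z \<Longrightarrow> le x z"
  using po unfolding partial_order_on_set_def by blast+

definition lt :: "'a \<Rightarrow> 'a \<Rightarrow> bool" where
  "lt x y \<longleftrightarrow> le x y \<and> x \<noteq> y"

lemma le_lt_trans: "x \<in> P \<Longrightarrow> y \<in> P \<Longrightarrow> z \<in> P \<Longrightarrow> le x y \<Longrightarrow> lt y z \<Longrightarrow> lt x z"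
  unfolding lt_def using le_trans[of x y z] le_antisym[of y z] by metis

lemma ex_minimal:
  assumes "A \<subseteq> P" "A \<noteq> {}"
  shows "\<exists>m\<in>A. \<forall>x\<in>A. le x m \<longrightarrow> x = m"
proof -
  have "finite A" using assms finP finite_subset by blast
  then show ?thesis using assms(2,1)
  proof (induction rule: finite_ne_induct)
    case (insert a A)
    then obtain m where m: "m \<in> A" "\<forall>x\<in>A. le x m \<longrightarrow> x = m" by blast
    show ?case
    proof (cases "le a m")
      case True
      have "x = a" if x: "x \<in> A" "le x a" for x
      proof -
        have "x \<in> P" "a \<in> P" "m \<in> P" using x(1) m(1) insert.prems by auto
        then show ?thesis using le_trans[of x a m] le_antisym[of x a] True x m(2) by metis
      qed
      then show ?thesis by blast
    next
      case False
      then show ?thesis using m by blast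
    qed
  qed simp
qed

lemma chain_min:
  assumes "is_chain le A" "A \<subseteq> P" "A \<noteq> {}"
  shows "\<exists>m\<in>A. \<forall>x\<in>A. le m x"
proof -
  obtain m where m: "m \<in> A" "\<forall>x\<in>A. le x m \<longrightarrow> x = m" using ex_minimal[OF assms(2,3)] by blast
  have "le m x" if "x \<in> A" for x
  proof -
    have "le m x \<or> le x m" using assms(1) m(1) that by (simp add: is_chain_def comparable_def)
    then show ?thesis using m that le_refl[of m] assms(2) by auto
  qed
  then show ?thesis using m(1) by blast
qed

lemma chain_max:
  assumes "is_chain le A" "A \<subseteq> P" "A \<noteq> {}"
  shows "\<exists>m\<in>A. \<forall>x\<in>A. le x m"
proof -
  have "partial_order_on_set P (\<lambda>x y. le y x)"
    unfolding partial_order_on_set_def using le_refl le_antisym le_trans by metis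
  then interpret dual: finite_poset P "\<lambda>x y. le y x" by (intro finite_poset.intro finP)
  show ?thesis using dual.chain_min[of A] assms by (simp add: is_chain_dual[of le])
qed

text \<open>Mirsky's argument: removing the minimal elements, an antichain, lowers the height, since
  the least element of a remaining nonempty chain has some \<open>y\<close> of \<open>Q\<close>
  strictly below it that extends the chain.\<close>

lemma card_le_height_width:
  "Q \<subseteq> P \<Longrightarrow> (\<And>Z. Z \<subseteq> Q \<Longrightarrow> is_chain le Z \<Longrightarrow> card Z \<le> m) \<Longrightarrow> card Q \<le> m * width P le"
proof (induction m arbitrary: Q)
  case 0
  have "Q = {}"
  proof (rule ccontr)
    assume "Q \<noteq> {}"
    then obtain x where "x \<in> Q" by blast
    then have "is_chain le {x}" using "0.prems"(1) le_refl[of x]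
      by (auto simp: is_chain_def comparable_def)
    then show False using "0.prems"(2)[of "{x}"] \<open>x \<in> Q\<close> by simp
  qed
  then show ?case by simp
next
  case (Suc m)
  define B where "B = {x\<in>Q. \<forall>y\<in>Q. le y x \<longrightarrow> y = x}"
  have finQ: "finite Q" using Suc.prems(1) finP finite_subset by blast
  have "card B \<le> width P le"
    using Suc.prems(1) unfolding B_def
    by (intro card_le_width[OF finP]) (auto simp: is_antichain_def comparable_def)
  moreover have "card (Q - B) \<le> m * width P le"
  proof (rule Suc.IH)
    fix Z assume Z: "Z \<subseteq> Q - B" "is_chain le Z"
    show "card Z \<le> m"
    proof (cases "Z = {}")
      case False
      then obtain z where z: "z \<in> Z" "\<And>x. x \<in> Z \<Longrightarrow> le z x"
        using chain_min[OF Z(2)] Z(1) Suc.prems(1) by blast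
      then obtain y where y: "y \<in> Q" "le y z" "y \<noteq> z" using Z(1) unfolding B_def by blast
      have "le y x" if "x \<in> Z" for x
        using le_trans[OF _ _ _ y(2) z(2)[OF that]] y(1) z(1) that Z(1) Suc.prems(1) by blast
      then have "is_chain le (insert y Z)"
        using Z(2) le_refl[of y] y(1) Suc.prems(1) by (auto simp: is_chain_def comparable_def)
      then have "card (insert y Z) \<le> Suc m" using Suc.prems(2) y Z(1) by blast
      moreover have "y \<notin> Z" using z(2)[of y] y Z(1) z(1) le_antisym[of y z] Suc.prems(1) by blast
      moreover have "finite Z" using Z(1) finQ finite_subset by blast
      ultimately show ?thesis by simp
    qed simp
  qed (use Suc.prems in blast)
  moreover have "card Q = card B + card (Q - B)"
  proof -
    have "B \<subseteq> Q" by (auto simp: B_def)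
    then show ?thesis using finQ by (simp add: card_Diff_subset card_mono finite_subset)
  qed
  ultimately show ?case by simp
qed

text \<open>Counting strict up-sets extends the order to a linear preorder in which proper inclusion
  of up-sets already gives strictly different ranks.\<close>

definition rank :: "'a \<Rightarrow> nat" where
  "rank x = card P - card {y\<in>P. lt x y}"

lemma rank_less_iff: "rank x < rank y \<longleftrightarrow> card {z\<in>P. lt y z} < card {z\<in>P. lt x z}"
proof -
  have "card {z\<in>P. lt v z} \<le> card P" for v using finP by (intro card_mono) auto
  from this[of x] this[of y] show ?thesis unfolding rank_def by arith
qed

lemma rank_strict_mono:
  assumes "x \<in> P" "y \<in> P" "lt x y"
  shows "rank x < rank y"
proof -
  have "{z\<in>P. lt y z} \<subset> {z\<in>P. lt x z}"
    using assms le_lt_trans[OF assms(1,2)] by (auto simp: lt_def)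
  then show ?thesis unfolding rank_less_iff using finP by (intro psubset_card_mono) auto
qed

lemma rank_mono: "x \<in> P \<Longrightarrow> y \<in> P \<Longrightarrow> le x y \<Longrightarrow> rank x \<le> rank y"
  using rank_strict_mono lt_def by (metis less_imp_le_nat order_refl)

lemma rank_le: "rank x \<le> card P"
  by (simp add: rank_def)

text \<open>If \<open>k+k\<close> is absent and no element of \<open>A\<close> is below one of \<open>B\<close>, then appending any
  \<open>y > f\<close> to \<open>A\<close> yields \<open>e < y\<close>, so the strict up-set of \<open>f\<close> is properly contained in that of \<open>e\<close>.\<close>

lemma chains_comparable:
  assumes nokk: "\<not> contains_kk P le k" and "k \<ge> 2"
    and A: "A \<subseteq> P" "is_chain le A" "card A \<ge> k - 1" "\<And>a. a \<in> A \<Longrightarrow> rank a \<le> s"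
    and B: "B \<subseteq> P" "is_chain le B" "card B \<ge> k" "\<And>b. b \<in> B \<Longrightarrow> s \<le> rank b"
  shows "\<exists>a\<in>A. \<exists>b\<in>B. le a b"
proof (rule ccontr)
  assume no: "\<not> ?thesis"
  have fin: "finite A" "finite B" using A B finP finite_subset by blast+
  have "A \<noteq> {}" "B \<noteq> {}" using A(3) B(3) \<open>k \<ge> 2\<close> by auto
  obtain f where f: "f \<in> A" "\<And>a. a \<in> A \<Longrightarrow> le a f" using chain_max A \<open>A \<noteq> {}\<close> by blast
  obtain e where e: "e \<in> B" "\<And>b. b \<in> B \<Longrightarrow> le e b" using chain_min B \<open>B \<noteq> {}\<close> by blast
  have eP: "e \<in> P" and fP: "f \<in> P" using e f A B by auto
  have up: "lt e y" if y: "y \<in> P" "lt f y" for y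
  proof -
    have lt: "lt a y" if "a \<in> A" for a
      using le_lt_trans[OF _ fP y(1) f(2)[OF that] y(2)] that A(1) by blast
    then have "y \<notin> A" by (auto simp: lt_def)
    then have "card (insert y A) \<ge> k" using A(3) fin \<open>k \<ge> 2\<close> by simp
    then obtain A' where A': "A' \<subseteq> insert y A" "card A' = k"
      using obtain_subset_with_card_n by metis
    obtain B' where B': "B' \<subseteq> B" "card B' = k" using B(3) obtain_subset_with_card_n by metis
    have "is_chain le (insert y A)"
      using lt A(2) le_refl[OF y(1)] by (auto simp: is_chain_def comparable_def lt_def)
    then have "is_chain le A'" "is_chain le B'" using A' B' B(2) is_chain_subset by blast+
    moreover have "A' \<subseteq> P" "B' \<subseteq> P" using A' B' A B y by auto
    \<comment> \<open>The comparability can only be \<open>le b a\<close>: \<open>le a b\<close>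
      contradicts \<open>no\<close>, directly or, if \<open>a = y\<close>, through \<open>f\<close>.
      Hence \<open>e\<close> is below \<open>b\<close>, which is below \<open>y\<close>.\<close>
    ultimately obtain a b where ab: "a \<in> insert y A" "b \<in> B" "le a b \<or> le b a"
      using nokk A' B' unfolding contains_kk_def comparable_def by (metis subset_iff)
    have bP: "b \<in> P" using ab B by auto
    have "\<not> le y b" using le_trans[OF fP y(1) bP] y(2) no f(1) ab(2) unfolding lt_def by blast
    then have "\<not> le a b" using ab no by blast
    then have "le b a" using ab(3) by blast
    then have "le b y" using ab(1) lt A(1) le_trans[OF bP _ y(1)] unfolding lt_def by blast
    then have "le e y" using le_trans[OF eP bP y(1)] e(2)[OF ab(2)] by blast
    moreover have "e \<noteq> y" using y(2) no f(1) e(1) unfolding lt_def by blast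
    ultimately show ?thesis by (simp add: lt_def)
  qed
  \<comment> \<open>A second element of \<open>B\<close> lies above \<open>e\<close> but not above
    \<open>f\<close>, which makes the inclusion of up-sets proper.\<close>
  have "B \<noteq> {e}" using B(3) \<open>k \<ge> 2\<close> by auto
  then obtain b where b: "b \<in> B" "b \<noteq> e" using e(1) by blast
  then have "lt e b" "\<not> lt f b" "b \<in> P" using e(2) no f(1) B(1) unfolding lt_def by blast+
  then have "{y\<in>P. lt f y} \<subset> {y\<in>P. lt e y}" using up by blast
  then have "rank e < rank f" unfolding rank_less_iff using finP by (intro psubset_card_mono) auto
  then show False using A(4)[OF f(1)] B(4)[OF e(1)] by simp
qed

text \<open>An integer \<open>s\<close> cuts \<open>P\<close> into the elements of rank at least \<open>s\<close> and those of smaller rank; it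
  lies in \<open>span k x\<close> iff \<open>x\<close> is among the lowest \<open>k - 1\<close> levels of the former or the highest \<open>k - 2\<close>
  levels of the latter. Levels are antichains, which gives the bound \<open>(2k - 3)w\<close> below without
  recourse to Dilworth's theorem.\<close>

definition short_below :: "nat \<Rightarrow> 'a \<Rightarrow> nat \<Rightarrow> bool" where
  "short_below k x s \<longleftrightarrow>
     (\<forall>Z. Z \<subseteq> {y\<in>P. lt y x \<and> s \<le> rank y} \<longrightarrow> is_chain le Z \<longrightarrow> card Z \<le> k - 2)"

text \<open>Non-strict, unlike \<open>short_below\<close>: \<open>x\<close> itself counts, hence one
  level fewer.\<close>

definition short_above :: "nat \<Rightarrow> 'a \<Rightarrow> nat \<Rightarrow> bool" where
  "short_above k x s \<longleftrightarrow>
     (\<forall>Z. Z \<subseteq> {y\<in>P. le x y \<and> rank y < s} \<longrightarrow> is_chain le Z \<longrightarrow> card Z \<le> k - 2)"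

text \<open>For \<open>x\<close> in \<open>P\<close> only one condition matters at each
  \<open>s\<close>: \<open>short_above\<close> is vacuous when \<open>s\<close> is at most
  \<open>rank x\<close>, and \<open>short_below\<close> when \<open>s\<close> is at least
  \<open>rank x\<close>.\<close>

definition span :: "nat \<Rightarrow> 'a \<Rightarrow> nat set" where
  "span k x = {s. s \<le> card P \<and> short_below k x s \<and> short_above k x s}"

section \<open>Convexity, intersection and density of spans\<close>

lemma short_below_mono:
  assumes "short_below k x s" "s \<le> s'"
  shows "short_below k x s'"
  unfolding short_below_def
proof (intro allI impI)
  fix Z assume "Z \<subseteq> {y\<in>P. lt y x \<and> s' \<le> rank y}" "is_chain le Z"
  moreover from this(1) have "Z \<subseteq> {y\<in>P. lt y x \<and> s \<le> rank y}" using assms(2) by force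
  ultimately show "card Z \<le> k - 2"
    using assms(1)[unfolded short_below_def, rule_format, of Z] by simp
qed

lemma short_above_antimono:
  assumes "short_above k x s" "s' \<le> s"
  shows "short_above k x s'"
  unfolding short_above_def
proof (intro allI impI)
  fix Z assume "Z \<subseteq> {y\<in>P. le x y \<and> rank y < s'}" "is_chain le Z"
  moreover from this(1) have "Z \<subseteq> {y\<in>P. le x y \<and> rank y < s}" using assms(2) by force
  ultimately show "card Z \<le> k - 2"
    using assms(1)[unfolded short_above_def, rule_format, of Z] by simp
qed

lemma order_convex_span: "order_convex (span k x)"
  unfolding order_convex_def
proof (intro ballI subsetI)
  fix a b s assume "a \<in> span k x" "b \<in> span k x" "s \<in> {a..b}"
  then show "s \<in> span k x"
    using short_below_mono[of k x a s] short_above_antimono[of k x b s] by (simp add: span_def)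
qed

lemma short_below_rank:
  assumes "x \<in> P"
  shows "short_below k x (rank x)"
proof -
  have empty: "{y\<in>P. lt y x \<and> rank x \<le> rank y} = {}" using rank_strict_mono[of _ x] assms by force
  show ?thesis unfolding short_below_def empty by simp
qed

lemma short_above_rank:
  assumes "x \<in> P"
  shows "short_above k x (rank x)"
proof -
  have empty: "{y\<in>P. le x y \<and> rank y < rank x} = {}" using rank_mono[of x] assms by force
  show ?thesis unfolding short_above_def empty by simp
qed

lemma rank_in_span: "x \<in> P \<Longrightarrow> rank x \<in> span k x"
  by (simp add: span_def rank_le short_below_rank short_above_rank)

text \<open>Take the largest \<open>s\<close> up to \<open>rank y\<close> allowed by
  \<open>short_above\<close> for \<open>x\<close>. If \<open>short_below\<close> failed for
  \<open>y\<close>, there would be long chains above \<open>x\<close> and below \<open>y\<close> on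
  the two sides of \<open>s\<close>; \<open>chains_comparable\<close> would link them and put
  \<open>x\<close> below \<open>y\<close>.\<close>

lemma span_meet_aux:
  assumes nokk: "\<not> contains_kk P le k" and "k \<ge> 2" and xy: "x \<in> P" "y \<in> P"
    and inc: "\<not> comparable le x y" and r: "rank x \<le> rank y"
  shows "span k x \<inter> span k y \<noteq> {}"
proof -
  let ?T = "{s. s \<le> rank y \<and> short_above k x s}"
  define s where "s = Max ?T"
  have fin: "finite ?T" by simp
  have "rank x \<in> ?T" using r short_above_rank xy by simp
  then have "?T \<noteq> {}" "rank x \<le> s" unfolding s_def using Max_ge[OF fin] by (blast, blast)
  then have "s \<in> ?T" unfolding s_def by (intro Max_in fin)
  then have s: "s \<le> rank y" "short_above k x s" by auto
  have below: "short_below k y s"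
  proof (rule ccontr)
    assume neg: "\<not> ?thesis"
    then have "s \<noteq> rank y" using short_below_rank[OF xy(2)] by blast
    then have "Suc s \<le> rank y" using s by simp
    \<comment> \<open>Failure at \<open>Suc s\<close> bounds the ranks in \<open>A\<close> by
      \<open>s\<close> itself; ties with \<open>B\<close> at rank \<open>s\<close> are harmless in
      \<open>chains_comparable\<close>.\<close>
    then have "\<not> short_above k x (Suc s)"
      using Max_ge[OF fin, of "Suc s"] by (auto simp flip: s_def)
    then obtain A where A: "A \<subseteq> {z\<in>P. le x z \<and> rank z < Suc s}" "is_chain le A"
        "\<not> card A \<le> k - 2"
      unfolding short_above_def by blast
    obtain B where B: "B \<subseteq> {z\<in>P. lt z y \<and> s \<le> rank z}" "is_chain le B"
        "\<not> card B \<le> k - 2"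
      using neg unfolding short_below_def by blast
    have AP: "a \<in> P" "le x a" "rank a \<le> s" if "a \<in> A" for a using A(1) that by auto
    have BP: "b \<in> P" "le b y" "b \<noteq> y" "s \<le> rank b" if "b \<in> B" for b
      using B(1) that by (auto simp: lt_def)
    have "B \<subseteq> P" "y \<notin> B" using BP by blast+
    \<comment> \<open>\<open>B\<close> supplies only \<open>k - 1\<close> elements; \<open>y\<close>
      is the missing one.\<close>
    then have "card (insert y B) = Suc (card B)" using finite_subset[OF _ finP] by simp
    then have "k \<le> card (insert y B)" using B(3) by simp
    moreover have "is_chain le (insert y B)"
      using B(2) BP(2) le_refl[OF xy(2)] by (simp add: is_chain_def comparable_def)
    moreover have "A \<subseteq> P" "insert y B \<subseteq> P" using AP BP xy by blast+
    moreover have "k - 1 \<le> card A" using A(3) by simp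
    moreover have "s \<le> rank b" if "b \<in> insert y B" for b using that BP(4) s(1) by blast
    ultimately have "\<exists>a\<in>A. \<exists>b\<in>insert y B. le a b"
      by (intro chains_comparable[OF nokk \<open>k \<ge> 2\<close> _ A(2) _ AP(3)])
    then obtain a b where ab: "a \<in> A" "b \<in> insert y B" "le a b" by blast
    have "le b y" "b \<in> P" using ab(2) BP le_refl[OF xy(2)] xy(2) by auto
    moreover have "le x a" "a \<in> P" using AP ab(1) by auto
    ultimately have "le x y"
      using le_trans[of x a b] le_trans[of x b y] ab(3) xy by blast
    then show False using inc by (simp add: comparable_def)
  qed
  have "s \<le> card P" using s(1) rank_le[of y] by simp
  moreover have "short_below k x s" using short_below_mono short_below_rank xy \<open>rank x \<le> s\<close> by blast
  moreover have "short_above k y s" using short_above_antimono short_above_rank xy s by blast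
  ultimately have "s \<in> span k x \<inter> span k y" using s below by (simp add: span_def)
  then show ?thesis by blast
qed

lemma span_meet:
  assumes "\<not> contains_kk P le k" "k \<ge> 2" "x \<in> P" "y \<in> P" "\<not> comparable le x y"
  shows "span k x \<inter> span k y \<noteq> {}"
proof (cases "rank x \<le> rank y")
  case False
  then show ?thesis using span_meet_aux[of k y x] assms by (auto simp: comparable_def)
qed (use span_meet_aux assms in blast)

text \<open>In \<open>?H\<close> the top of a chain has at most \<open>k - 2\<close> chain elements
  below it; in \<open>?L\<close> the bottom is included in the count. So the heights are at most
  \<open>k - 1\<close> and \<open>k - 2\<close>, which add up to \<open>2 * k - 3\<close>.\<close>

lemma card_span_le:
  assumes "k \<ge> 2"
  shows "card {x\<in>P. s \<in> span k x} \<le> (2 * k - 3) * width P le"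
proof -
  let ?H = "{x\<in>P. s \<le> rank x \<and> short_below k x s}"
  let ?L = "{x\<in>P. rank x < s \<and> short_above k x s}"
  have "card ?H \<le> (k - 1) * width P le"
  proof (rule card_le_height_width)
    fix Z assume Z: "Z \<subseteq> ?H" "is_chain le Z"
    show "card Z \<le> k - 1"
    proof (cases "Z = {}")
      case False
      then obtain z where z: "z \<in> Z" "\<And>x. x \<in> Z \<Longrightarrow> le x z" using chain_max[OF Z(2)] Z(1) by blast
      then have "Z - {z} \<subseteq> {y\<in>P. lt y z \<and> s \<le> rank y}" "is_chain le (Z - {z})"
        using Z is_chain_subset[OF Z(2), of "Z - {z}"] by (auto simp: lt_def)
      then have "card (Z - {z}) \<le> k - 2" using z Z(1) unfolding short_below_def by blast
      moreover have "finite Z" using Z(1) finP finite_subset[of Z P] by auto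
      ultimately show ?thesis using z(1) assms by simp
    qed simp
  qed auto
  moreover have "card ?L \<le> (k - 2) * width P le"
  proof (rule card_le_height_width)
    fix Z assume Z: "Z \<subseteq> ?L" "is_chain le Z"
    show "card Z \<le> k - 2"
    proof (cases "Z = {}")
      case False
      then obtain z where z: "z \<in> Z" "\<And>x. x \<in> Z \<Longrightarrow> le z x" using chain_min[OF Z(2)] Z(1) by blast
      then have "Z \<subseteq> {y\<in>P. le z y \<and> rank y < s}" using Z by auto
      then show ?thesis using z Z unfolding short_above_def by blast
    qed simp
  qed auto
  moreover have "card {x\<in>P. s \<in> span k x} \<le> card (?H \<union> ?L)"
    using finP by (intro card_mono) (auto simp: span_def)
  moreover have "card (?H \<union> ?L) \<le> card ?H + card ?L" by (rule card_Un_le)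
  moreover have "(k - 1) * width P le + (k - 2) * width P le = (2 * k - 3) * width P le"
  proof -
    have "(k - 1) + (k - 2) = 2 * k - 3" using assms by simp
    then show ?thesis by (metis add_mult_distrib)
  qed
  ultimately show ?thesis by linarith
qed

end

section \<open>The First-Fit bound\<close>

theorem theorem5:
  fixes P :: "'a set" and le :: "'a \<Rightarrow> 'a \<Rightarrow> bool" and k :: nat and Cs :: "'a set list"
  assumes "finite P"
    and "partial_order_on_set P le"
    and "k \<ge> 2"
    and "\<not> contains_kk P le k"
    and "first_fit_partition P le Cs"
  shows "length Cs \<le> 8 * (2 * k - 3) * width P le"
proof -
  interpret finite_poset P le by unfold_locales (fact assms)+
  let ?q = "length Cs"
  have sub: "Cs ! i \<subseteq> P" if "i < ?q" for i
    using assms(5) that nth_mem unfolding first_fit_partition_def by blast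
  have disj: "i = j" if "i < ?q" "j < ?q" "x \<in> Cs ! i" "x \<in> Cs ! j" for i j x
    using assms(5) that unfolding first_fit_partition_def by blast
  have "?q \<le> 8 * ((2 * k - 3) * width P le)"
  proof (rule first_fit_intervals[where C = "\<lambda>i. Cs ! i" and I = "span k" and n = "card P"])
    fix i assume "i < ?q"
    then show "Cs ! i \<noteq> {}" using assms(5) by (simp add: first_fit_partition_def)
  next
    show "order_convex (span k v)" for v by (rule order_convex_span)
  next
    fix i v assume i: "i < ?q" and v: "v \<in> Cs ! i"
    show "span k v \<noteq> {} \<and> span k v \<subseteq> {..card P}"
      using rank_in_span[of v k] sub[OF i] v unfolding span_def by blast
  next
    fix i j v assume ij: "i < j" "j < ?q" and v: "v \<in> Cs ! j"
    then obtain u where u: "u \<in> Cs ! i" "\<not> comparable le u v"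
      using assms(5) unfolding first_fit_partition_def by blast
    moreover have "u \<in> P" "v \<in> P" using sub[of i] sub[of j] ij u(1) v by auto
    ultimately show "\<exists>u\<in>Cs ! i. span k u \<inter> span k v \<noteq> {}"
      using span_meet[OF assms(4,3)] by blast
  next
    fix p
    let ?R = "{i. i < ?q \<and> p \<in> (\<Union>v\<in>Cs ! i. span k v)}"
    \<comment> \<open>Density counts classes, not points: choosing one point per class is injective
      because the classes are disjoint.\<close>
    have "\<forall>i\<in>?R. \<exists>v. v \<in> Cs ! i \<and> p \<in> span k v" by blast
    then obtain g where g: "\<forall>i\<in>?R. g i \<in> Cs ! i \<and> p \<in> span k (g i)"
      by (rule bchoice[THEN exE])
    have "inj_on g ?R"
    proof (rule inj_onI)
      fix i j assume ij: "i \<in> ?R" "j \<in> ?R" "g i = g j"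
      then have "g i \<in> Cs ! i" "g i \<in> Cs ! j" using g by force+
      then show "i = j" using disj ij by blast
    qed
    moreover have "g ` ?R \<subseteq> {x\<in>P. p \<in> span k x}" using g sub by blast
    ultimately have "card ?R \<le> card {x\<in>P. p \<in> span k x}" using finP by (intro card_inj_on_le) auto
    then show "card ?R \<le> (2 * k - 3) * width P le" using card_span_le[OF assms(3), of p] by simp
  qed
  then show ?thesis by (simp add: mult.assoc)
qed

end
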